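(* For $g \in \{2,3,5,10\}$ there is a constant $C_g>0$ such that for all $N \geqslant 1$, $$P_g(N) \leqslant C_g\, \vartheta_g^N,$$ where $\vartheta_2 = 5^{1/3}$, $\vartheta_3 = 2$, $\vartheta_5 = 2$, $\vartheta_{10} = 6$.
   Context: For an integer $g\geqslant 2$ and a finite tuple of $g$-ary digits $(d_0,\ldots,d_{N-1}) \in \{0,\ldots,g-1\}^N$ with $d_{N-1} \neq 0$ (equivalently, an infinite digit sequence $\mathcal{D}=\{d_i\}_{i\ge 0}$ whose last non-zero element is $d_{N-1}$; such $\mathcal{D}$ is said to have length $N$), define $u_{\mathcal{D},g}(n) = \sum_{i=0}^{n-1} d_i g^i$ and let $\varpi_{\mathcal{D},g}(N)$ be the number of $n$ with $1 \leqslant n \leqslant N$ for which $u_{\mathcal{D},g}(n)$ is prime. Let $\eta = 1$ if $g=2$ and $\eta = 0$ if $g \geqslant 3$. Then $P_g(N)$ denotes the number of sequences $\mathcal{D}$ of length $N$ such that $\varpi_{\mathcal{D},g}(N) = N - \eta$. *)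

theory Defs
  imports Complex_Main "HOL-Computational_Algebra.Primes"
begin

definition digit_seqs :: "nat \<Rightarrow> nat \<Rightarrow> (nat \<Rightarrow> nat) set" where
  "digit_seqs g N = {D. 1 \<le> N \<and> (\<forall>i. D i < g) \<and> D (N - 1) \<noteq> 0 \<and> (\<forall>i\<ge>N. D i = 0)}"

definition u :: "(nat \<Rightarrow> nat) \<Rightarrow> nat \<Rightarrow> nat \<Rightarrow> nat" where
  "u D g n = (\<Sum>i<n. D i * g ^ i)"

definition varpi :: "(nat \<Rightarrow> nat) \<Rightarrow> nat \<Rightarrow> nat \<Rightarrow> nat" where
  "varpi D g N = card {n. 1 \<le> n \<and> n \<le> N \<and> prime (u D g n)}"

definition eta :: "nat \<Rightarrow> nat" where
  "eta g = (if g = 2 then 1 else 0)"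

definition P :: "nat \<Rightarrow> nat \<Rightarrow> nat" where
  "P g N = card {D \<in> digit_seqs g N. varpi D g N = N - eta g}"

definition theta :: "nat \<Rightarrow> real" where
  "theta g =
    (if g = 2 then 5 powr (1 / 3)
     else if g = 3 then 2
     else if g = 5 then 2
     else if g = 10 then 6
     else undefined)"

lemma finite_digit_seqs: "finite (digit_seqs g N)"
proof (rule finite_subset)
  show "digit_seqs g N \<subseteq> {D. \<forall>i. (i \<in> {..<N} \<longrightarrow> D i \<in> {..<g}) \<and> (i \<notin> {..<N} \<longrightarrow> D i = 0)}"
    by (auto simp: digit_seqs_def)
  show "finite {D :: nat \<Rightarrow> nat. \<forall>i. (i \<in> {..<N} \<longrightarrow> D i \<in> {..<g}) \<and> (i \<notin> {..<N} \<longrightarrow> D i = 0)}"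
    by (rule finite_set_of_finite_funs) auto
qed

end

theory Submission
  imports Defs "HOL-Number_Theory.Cong" "HOL-Library.Code_Binary_Nat"
begin

text \<open>
  Choose a modulus \<open>M\<close> coprime to \<open>g\<close> and attach to a prefix of length \<open>n\<close> and value \<open>x\<close> the state
  \<open>r = x / g ^ n\<close> modulo \<open>M\<close>; appending the digit \<open>d\<close> moves \<open>r\<close> to \<open>(r + d) / g\<close>, whatever \<open>n\<close> is.
  As long as the values are primes not dividing \<open>M\<close>, the states remain units, so the number of
  admissible prefixes is governed by a finite transfer matrix on the units modulo \<open>M\<close>. Weighting each
  prefix by the number of admissible walks of length \<open>k\<close> from its state, the total weight grows by a
  factor of at most \<open>\<theta>\<close> per digit as soon as \<open>A ^ (k + 1) 1 \<le> \<theta> A ^ k 1\<close> for this matrix \<open>A\<close>. The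
  moduli \<open>3, 2, 6, 273\<close> with \<open>k = 2, 0, 0, 1\<close> suffice for \<open>g = 2, 3, 5, 10\<close>. A prefix whose value is
  one of the finitely many primes dividing \<open>M\<close> either stays put (digit \<open>0\<close>) or leaves this set for
  good, so it can be given a large constant weight.
\<close>

section \<open>Admissible walks on the units modulo \<open>M\<close>\<close>

fun unit_walks :: "nat \<Rightarrow> nat \<Rightarrow> nat \<Rightarrow> nat \<Rightarrow> nat \<Rightarrow> nat" where
  "unit_walks g h M 0 r = 1"
| "unit_walks g h M (Suc k) r =
    (\<Sum>d\<leftarrow>[0..<g]. if coprime (r + d) M then unit_walks g h M k ((r + d) * h mod M) else 0)"

text \<open>One row of the transfer matrix applied to the previous vector. In the intended use
  \<open>h\<close> is inverse to \<open>g\<close> modulo \<open>M\<close>, so coprimality may be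
  tested on \<open>r + d\<close>, before the factor \<open>h\<close>.\<close>

lemma unit_walks_Suc:
  "unit_walks g h M (Suc k) r =
    (\<Sum>d | d < g \<and> coprime (r + d) M. unit_walks g h M k ((r + d) * h mod M))"
proof -
  have "unit_walks g h M (Suc k) r =
      (\<Sum>d<g. if coprime (r + d) M then unit_walks g h M k ((r + d) * h mod M) else 0)"
    by (simp add: interv_sum_list_conv_sum_set_nat lessThan_atLeast0)
  also have "\<dots> = (\<Sum>d \<in> {..<g} \<inter> {d. coprime (r + d) M}. unit_walks g h M k ((r + d) * h mod M))"
    by (simp add: sum.inter_restrict)
  also have "{..<g} \<inter> {d. coprime (r + d) M} = {d. d < g \<and> coprime (r + d) M}"
    by auto
  finally show ?thesis .
qed

lemma unit_walks_le: "unit_walks g h M k r \<le> g ^ k"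
proof (induction k arbitrary: r)
  case (Suc k)
  have "unit_walks g h M (Suc k) r \<le> (\<Sum>d | d < g \<and> coprime (r + d) M. g ^ k)"
    unfolding unit_walks_Suc by (rule sum_mono) (rule Suc.IH)
  also have "\<dots> \<le> (\<Sum>d<g. g ^ k)"
    by (rule sum_mono2) auto
  finally show ?case by simp
qed simp

text \<open>From a unit the digit 0 is always admissible and leads to the unit \<open>r * h\<close>,
  so some walk of every length exists.\<close>

lemma unit_walks_pos:
  assumes "g > 0" "coprime h M" "coprime r M"
  shows "unit_walks g h M k r \<ge> 1"
  using assms(3)
proof (induction k arbitrary: r)
  case (Suc k)
  have "coprime (r * h mod M) M"
    using Suc.prems assms(2) by (cases "M = 0") (simp_all add: coprime_mod_left_iff)
  then have "1 \<le> unit_walks g h M k ((r + 0) * h mod M)"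
    using Suc.IH by simp
  also have "\<dots> \<le> unit_walks g h M (Suc k) r"
    unfolding unit_walks_Suc using Suc.prems assms(1)
    by (intro member_le_sum) auto
  finally show ?case .
qed simp

section \<open>Prime prefixes and their extension by one digit\<close>

definition prime_prefixes :: "nat \<Rightarrow> nat \<Rightarrow> nat \<Rightarrow> (nat \<Rightarrow> nat) set" where
  "prime_prefixes g s n =
    {D. (\<forall>i. D i < g) \<and> (\<forall>i\<ge>n. D i = 0) \<and> (\<forall>m\<in>{s..n}. prime (u D g m))}"

lemma finite_prime_prefixes: "finite (prime_prefixes g s n)"
proof (rule finite_subset)
  show "prime_prefixes g s n \<subseteq>
      {D. \<forall>i. (i \<in> {..<n} \<longrightarrow> D i \<in> {..<g}) \<and> (i \<notin> {..<n} \<longrightarrow> D i = 0)}"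
    by (auto simp: prime_prefixes_def)
  show "finite {D :: nat \<Rightarrow> nat. \<forall>i. (i \<in> {..<n} \<longrightarrow> D i \<in> {..<g}) \<and> (i \<notin> {..<n} \<longrightarrow> D i = 0)}"
    by (rule finite_set_of_finite_funs) auto
qed

lemma u_Suc: "u D g (Suc n) = u D g n + D n * g ^ n"
  by (simp add: u_def)

lemma u_fun_upd: "m \<le> n \<Longrightarrow> u (D(n := d)) g m = u D g m"
  by (simp add: u_def)

text \<open>The bijection splits \<open>D\<close> into \<open>D(n := 0)\<close> and the digit
  \<open>D n\<close>. Top digits may be zero, so truncation stays among the prefixes.\<close>

lemma sum_prime_prefixes_Suc:
  fixes f :: "nat \<Rightarrow> real"
  assumes "s \<le> n" "g > 0"
  shows "(\<Sum>D\<in>prime_prefixes g s (Suc n). f (u D g (Suc n))) =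
    (\<Sum>D\<in>prime_prefixes g s n. \<Sum>d | d < g \<and> prime (u D g n + d * g ^ n). f (u D g n + d * g ^ n))"
proof -
  define S where "S = (\<lambda>D. {d. d < g \<and> prime (u D g n + d * g ^ n)})"
  have Suc_upd: "u (D(n := d)) g (Suc n) = u D g n + d * g ^ n" for D d
    by (simp add: u_Suc u_fun_upd)
  have "(\<Sum>D\<in>prime_prefixes g s (Suc n). f (u D g (Suc n))) =
      (\<Sum>(D, d)\<in>Sigma (prime_prefixes g s n) S. f (u D g n + d * g ^ n))"
  proof (rule sum.reindex_bij_witness[where i = "\<lambda>(D, d). D(n := d)" and j = "\<lambda>D. (D(n := 0), D n)"])
    fix D assume D: "D \<in> prime_prefixes g s (Suc n)"
    have "prime (u D g n + D n * g ^ n)"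
      using D assms by (auto simp: prime_prefixes_def simp flip: u_Suc)
    then show "(D(n := 0), D n) \<in> Sigma (prime_prefixes g s n) S"
      using D assms by (auto simp: prime_prefixes_def S_def u_fun_upd)
    show "(case (D(n := 0), D n) of (D, d) \<Rightarrow> f (u D g n + d * g ^ n)) = f (u D g (Suc n))"
      by (simp add: u_Suc u_fun_upd)
  next
    fix z assume "z \<in> Sigma (prime_prefixes g s n) S"
    then obtain D d where z: "z = (D, d)" "D \<in> prime_prefixes g s n" "d \<in> S D"
      by auto
    then have "prime (u (D(n := d)) g m)" if "m \<in> {s..Suc n}" for m
      using that by (cases "m = Suc n") (auto simp: prime_prefixes_def S_def Suc_upd u_fun_upd)
    with z show "(case z of (D, d) \<Rightarrow> D(n := d)) \<in> prime_prefixes g s (Suc n)"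
      by (auto simp: prime_prefixes_def S_def)
    show "((case z of (D, d) \<Rightarrow> D(n := d))(n := 0), (case z of (D, d) \<Rightarrow> D(n := d)) n) = z"
      using z by (auto simp: prime_prefixes_def)
  qed auto
  also have "\<dots> = (\<Sum>D\<in>prime_prefixes g s n. \<Sum>d\<in>S D. f (u D g n + d * g ^ n))"
    by (rule sum.Sigma[symmetric]) (auto simp: S_def finite_prime_prefixes)
  finally show ?thesis by (simp add: S_def)
qed

section \<open>Weighted count of prefixes for a fixed modulus\<close>

locale prime_sieve =
  fixes g h M k :: nat and \<theta> :: real
  assumes g_ge: "g \<ge> 2"
    and M_gt: "M > 1"
    and inverse: "[g * h = 1] (mod M)"
    and \<theta>_gt: "\<theta> > 1"
    and contraction: "\<And>r. r < M \<Longrightarrow> coprime r M \<Longrightarrow>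
      real (unit_walks g h M (Suc k) r) \<le> \<theta> * real (unit_walks g h M k r)"
begin

text \<open>Chosen so that W + g^(k+1) \<le> \<theta> W; the summand 1 ensures W \<ge> 1.\<close>

definition trapped_weight :: real where
  "trapped_weight = 1 + real g ^ Suc k / (\<theta> - 1)"

definition weight :: "nat \<Rightarrow> nat \<Rightarrow> real" where
  "weight n x = (if x dvd M then trapped_weight else real (unit_walks g h M k (x * h ^ n mod M)))"

lemma coprime_h: "coprime h M"
  using inverse by (metis cong_solve_coprime_nat coprime_iff_invertible_nat mult.commute One_nat_def)

text \<open>Makes the total weight an upper bound for the number of prefixes.\<close>

lemma weight_ge_1:
  assumes "prime x"
  shows "weight n x \<ge> 1"
proof (cases "x dvd M")
  case True
  then show ?thesis using \<theta>_gt by (simp add: weight_def trapped_weight_def)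
next
  case False
  then have "coprime x M" using assms by (simp add: prime_imp_coprime)
  then have "coprime (x * h ^ n mod M) M"
    using coprime_h M_gt by (simp add: coprime_mod_left_iff)
  then have "unit_walks g h M k (x * h ^ n mod M) \<ge> 1"
    using unit_walks_pos[OF _ coprime_h] g_ge by simp
  with False show ?thesis by (simp add: weight_def)
qed

lemma weight_step:
  assumes "prime x" "M < g ^ n"
  shows "(\<Sum>d | d < g \<and> prime (x + d * g ^ n). weight (Suc n) (x + d * g ^ n)) \<le> \<theta> * weight n x"
proof -
  let ?S = "{d. d < g \<and> prime (x + d * g ^ n)}"
  \<comment> \<open>A nonzero digit adds at least \<open>g ^ n\<close>, which exceeds
    \<open>M\<close>.\<close>
  have leaves: "\<not> x + d * g ^ n dvd M" if "d \<noteq> 0" for d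
  proof
    assume "x + d * g ^ n dvd M"
    then have "x + d * g ^ n \<le> M" using M_gt by (intro dvd_imp_le) auto
    moreover have "g ^ n \<le> d * g ^ n" using that by simp
    ultimately show False using assms(2) by linarith
  qed
  show ?thesis
  proof (cases "x dvd M")
    case True
    \<comment> \<open>Only the digit 0 keeps the value a divisor of \<open>M\<close>; every other
      successor weighs at most \<open>g ^ k\<close>.\<close>
    have "(\<Sum>d\<in>?S. weight (Suc n) (x + d * g ^ n))
        \<le> (\<Sum>d\<in>?S. (if d = 0 then trapped_weight else 0) + real g ^ k)"
    proof (rule sum_mono)
      fix d
      show "weight (Suc n) (x + d * g ^ n) \<le> (if d = 0 then trapped_weight else 0) + real g ^ k"
        using True leaves[of d] unit_walks_le[of g h M k]
        by (auto simp: weight_def simp flip: of_nat_power)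
    qed
    also have "\<dots> \<le> (\<Sum>d<g. (if d = 0 then trapped_weight else 0) + real g ^ k)"
      using \<theta>_gt by (intro sum_mono2) (auto simp: trapped_weight_def)
    also have "\<dots> = trapped_weight + real g ^ Suc k"
      using g_ge by (simp add: sum.distrib)
    also have "\<dots> \<le> \<theta> * trapped_weight"
    proof -
      have "(\<theta> - 1) * trapped_weight = \<theta> - 1 + real g ^ Suc k"
        using \<theta>_gt by (simp add: trapped_weight_def distrib_left)
      then show ?thesis using \<theta>_gt by (simp add: left_diff_distrib)
    qed
    finally show ?thesis using True by (simp add: weight_def)
  next
    case False
    define r where "r = x * h ^ n mod M"
    have cop: "coprime r M"
      using False assms(1) coprime_h M_gt by (simp add: r_def prime_imp_coprime coprime_mod_left_iff)
    have gh: "[(g * h) ^ n = 1] (mod M)"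
      using cong_pow[OF inverse, of n] by simp
    \<comment> \<open>Since \<open>g * h\<close> is 1 modulo \<open>M\<close>, scaling by
      \<open>h ^ n\<close> turns the new term into the bare digit, independently of
      \<open>n\<close>.\<close>
    have shift: "[(x + d * g ^ n) * h ^ n = r + d] (mod M)" for d
    proof -
      have "(x + d * g ^ n) * h ^ n = x * h ^ n + d * (g * h) ^ n"
        by (simp add: algebra_simps power_mult_distrib)
      also have "[\<dots> = r + d * 1] (mod M)"
        by (intro cong_add cong_mult cong_refl gh) (simp add: r_def)
      finally show ?thesis by simp
    qed
    have state: "(x + d * g ^ n) * h ^ Suc n mod M = (r + d) * h mod M" for d
      using cong_mult[OF shift[of d] cong_refl[of h]]
      by (simp add: cong_def mult.assoc mult.left_commute mult.commute)
    have ndvd: "\<not> x + d * g ^ n dvd M" for d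
      using False leaves[of d] by (cases "d = 0") auto
    have adm: "coprime (r + d) M" if "d \<in> ?S" for d
    proof -
      have "coprime (x + d * g ^ n) M"
        using that ndvd[of d] by (simp add: prime_imp_coprime)
      then have "coprime ((x + d * g ^ n) * h ^ n) M"
        using coprime_h by simp
      then show ?thesis
        using cong_imp_coprime[OF shift[of d]] by blast
    qed
    have "(\<Sum>d\<in>?S. weight (Suc n) (x + d * g ^ n))
        = (\<Sum>d\<in>?S. real (unit_walks g h M k ((r + d) * h mod M)))"
      using ndvd by (intro sum.cong refl) (simp only: weight_def state if_False)
    \<comment> \<open>Here primality is relaxed to coprimality with \<open>M\<close>.\<close>
    also have "\<dots> \<le> (\<Sum>d | d < g \<and> coprime (r + d) M. real (unit_walks g h M k ((r + d) * h mod M)))"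
      using adm by (intro sum_mono2) auto
    also have "\<dots> = real (unit_walks g h M (Suc k) r)"
      by (simp only: unit_walks_Suc of_nat_sum)
    also have "\<dots> \<le> \<theta> * real (unit_walks g h M k r)"
      using cop M_gt by (intro contraction) (auto simp: r_def)
    finally show ?thesis using False by (simp add: weight_def r_def)
  qed
qed

lemma card_prime_prefixes_bound:
  "\<exists>C>0. \<forall>n. real (card (prime_prefixes g s n)) \<le> C * \<theta> ^ n"
proof -
  \<comment> \<open>From \<open>n0\<close> on, all prefix values are prime and M < 2^n \<le> g^n, as
    \<open>weight_step\<close> requires.\<close>
  define n0 where "n0 = max s M"
  define T where "T n = (\<Sum>D\<in>prime_prefixes g s n. weight n (u D g n))" for n
  have prime_u: "prime (u D g n)" if "D \<in> prime_prefixes g s n" "n0 \<le> n" for D n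
    using that by (auto simp: prime_prefixes_def n0_def)
  have M_less: "M < g ^ n" if "n0 \<le> n" for n
  proof -
    have "M \<le> n" using that by (simp add: n0_def)
    also have "n < 2 ^ n" by (rule less_exp)
    also have "2 ^ n \<le> g ^ n" using g_ge by (rule power_mono) simp
    finally show ?thesis .
  qed
  have T_Suc: "T (Suc n) \<le> \<theta> * T n" if "n0 \<le> n" for n
  proof -
    have "T (Suc n) = (\<Sum>D\<in>prime_prefixes g s n.
        \<Sum>d | d < g \<and> prime (u D g n + d * g ^ n). weight (Suc n) (u D g n + d * g ^ n))"
      unfolding T_def using that g_ge by (intro sum_prime_prefixes_Suc) (auto simp: n0_def)
    also have "\<dots> \<le> (\<Sum>D\<in>prime_prefixes g s n. \<theta> * weight n (u D g n))"
      using that prime_u M_less by (intro sum_mono weight_step) auto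
    finally show ?thesis by (simp add: T_def sum_distrib_left)
  qed
  have T_nonneg: "T n \<ge> 0" if "n0 \<le> n" for n
    unfolding T_def using weight_ge_1 prime_u that
    by (intro sum_nonneg) (meson order_trans zero_le_one)
  have T_bound: "T (n0 + j) \<le> T n0 * \<theta> ^ j" for j
  proof (induction j)
    case (Suc j)
    have "T (n0 + Suc j) \<le> \<theta> * T (n0 + j)" using T_Suc[of "n0 + j"] by simp
    also have "\<dots> \<le> \<theta> * (T n0 * \<theta> ^ j)" using Suc \<theta>_gt by (intro mult_left_mono) auto
    finally show ?case by (simp add: mult_ac)
  qed simp
  have \<theta>_ge_1: "\<theta> ^ j \<ge> 1" for j using \<theta>_gt by simp
  \<comment> \<open>The sum covers lengths below \<open>n0\<close>, \<open>T n0\<close> the others;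
    1 gives positivity.\<close>
  define C where "C = 1 + T n0 + (\<Sum>n<n0. real (card (prime_prefixes g s n)))"
  have "C > 0" using T_nonneg[of n0] by (simp add: C_def add_pos_nonneg sum_nonneg)
  moreover have "real (card (prime_prefixes g s n)) \<le> C * \<theta> ^ n" for n
  proof (cases "n < n0")
    case True
    then have "real (card (prime_prefixes g s n)) \<le> (\<Sum>n<n0. real (card (prime_prefixes g s n)))"
      by (intro member_le_sum) auto
    also have "\<dots> \<le> C * 1" using T_nonneg[of n0] by (simp add: C_def)
    also have "\<dots> \<le> C * \<theta> ^ n" using \<open>C > 0\<close> \<theta>_ge_1[of n] by (intro mult_left_mono) auto
    finally show ?thesis .
  next
    case False
    have "real (card (prime_prefixes g s n)) = (\<Sum>D\<in>prime_prefixes g s n. 1)" by simp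
    also have "\<dots> \<le> T n"
      unfolding T_def using False prime_u weight_ge_1 by (intro sum_mono) auto
    also have "\<dots> \<le> T n0 * \<theta> ^ (n - n0)"
      using T_bound[of "n - n0"] False by simp
    also have "\<dots> \<le> C * \<theta> ^ n"
    proof (rule mult_mono)
      show "T n0 \<le> C" by (simp add: C_def sum_nonneg)
      show "\<theta> ^ (n - n0) \<le> \<theta> ^ n" using \<theta>_gt by (intro power_increasing) auto
    qed (use \<open>C > 0\<close> \<theta>_gt in auto)
    finally show ?thesis .
  qed
  ultimately show ?thesis by blast
qed

end

section \<open>Reduction of \<open>P\<close> to prime prefixes\<close>

lemma P_le_card_prime_prefixes:
  assumes "g \<ge> 2"
  shows "P g N \<le> card (prime_prefixes g (Suc (eta g)) N)"
  unfolding P_def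
proof (rule card_mono[OF finite_prime_prefixes], rule subsetI)
  fix D assume "D \<in> {D \<in> digit_seqs g N. varpi D g N = N - eta g}"
  then have D: "\<forall>i. D i < g" "\<forall>i\<ge>N. D i = 0"
    and card: "card {n. 1 \<le> n \<and> n \<le> N \<and> prime (u D g n)} = N - eta g"
    by (auto simp: digit_seqs_def varpi_def)
  have "{n. 1 \<le> n \<and> n \<le> N \<and> prime (u D g n)} \<subseteq> {Suc (eta g)..N}"
  proof
    fix n assume n: "n \<in> {n. 1 \<le> n \<and> n \<le> N \<and> prime (u D g n)}"
    \<comment> \<open>The first value is the digit \<open>D 0\<close>, which is below 2 in base 2
      and hence never prime.\<close>
    have "n \<noteq> 1" if "g = 2"
    proof
      assume "n = 1"
      then have "prime (D 0)" using n by (simp add: u_def)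
      then show False using D(1) that prime_ge_2_nat[of "D 0"] by (metis not_le)
    qed
    then show "n \<in> {Suc (eta g)..N}" using n by (auto simp: eta_def)
  qed
  \<comment> \<open>The interval has exactly \<open>N - eta g\<close> elements, so the inclusion is
    an equality.\<close>
  then have "{n. 1 \<le> n \<and> n \<le> N \<and> prime (u D g n)} = {Suc (eta g)..N}"
    by (rule card_subset_eq[rotated]) (use card in simp_all)
  then show "D \<in> prime_prefixes g (Suc (eta g)) N"
    using D by (auto simp: prime_prefixes_def)
qed

lemma (in prime_sieve) P_bound: "\<exists>C>0. \<forall>N\<ge>1. real (P g N) \<le> C * \<theta> ^ N"
  using card_prime_prefixes_bound[of "Suc (eta g)"] P_le_card_prime_prefixes[OF g_ge]
  by (meson of_nat_le_iff order_trans)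

section \<open>Numerical contraction for the four bases\<close>

lemma theta_2_ge: "theta 2 \<ge> 5 / 3"
proof -
  have "(5 / 3 :: real) = ((5 / 3) powr 3) powr (1 / 3)" by (subst powr_powr) simp
  \<comment> \<open>(5/3)^3 = 125/27 < 5.\<close>
  also have "\<dots> \<le> 5 powr (1 / 3)" by (rule powr_mono2) (simp_all add: power3_eq_cube)
  finally show ?thesis by (simp add: theta_def)
qed

text \<open>The counts are Fibonacci numbers: (3, 2) at k = 2 and (5, 3) at k = 3 for r = 1, 2. For
  k = 1 the ratio at r = 2 would still be 2.\<close>

lemma contraction_2:
  "list_all (\<lambda>r. coprime r 3 \<longrightarrow> 3 * unit_walks 2 2 3 3 r \<le> 5 * unit_walks 2 2 3 2 r) [0..<3]"
  by code_simp

text \<open>From an odd state only the digits 0 and 2 survive.\<close>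

lemma contraction_3:
  "list_all (\<lambda>r. coprime r 2 \<longrightarrow> unit_walks 3 1 2 1 r \<le> 2 * unit_walks 3 1 2 0 r) [0..<2]"
  by code_simp

text \<open>State 1 admits the digits 0 and 4, state 5 the digits 0 and 2.\<close>

lemma contraction_5:
  "list_all (\<lambda>r. coprime r 6 \<longrightarrow> unit_walks 5 5 6 1 r \<le> 2 * unit_walks 5 5 6 0 r) [0..<6]"
  by code_simp

text \<open>273 = 3 * 7 * 13 and 10 * 82 = 3 * 273 + 1. One step is not enough: r = 79 admits seven
  digits, since 84 is divisible by both 3 and 7 and 79..88 contains no multiple of 13. Averaging
  over a further step brings the factor down to 6.\<close>

lemma contraction_10:
  "list_all (\<lambda>r. coprime r 273 \<longrightarrow> unit_walks 10 82 273 2 r \<le> 6 * unit_walks 10 82 273 1 r) [0..<273]"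
  by code_simp

theorem theorem3p2:
  fixes g :: nat
  assumes "g \<in> {2, 3, 5, 10}"
  shows "\<exists>C::real. C > 0 \<and> (\<forall>N::nat. N \<ge> 1 \<longrightarrow> real (P g N) \<le> C * theta g ^ N)"
proof -
  consider "g = 2" | "g = 3" | "g = 5" | "g = 10" using assms by auto
  then show ?thesis
  proof cases
    case 1
    interpret prime_sieve 2 2 3 2 "theta 2"
    proof
      fix r :: nat assume "r < 3" "coprime r 3"
      then have "3 * unit_walks 2 2 3 3 r \<le> 5 * unit_walks 2 2 3 2 r"
        using contraction_2 by (simp only: list_all_iff set_upt atLeastLessThan_iff) simp
      then have "real (unit_walks 2 2 3 3 r) \<le> 5 / 3 * real (unit_walks 2 2 3 2 r)"
        by linarith
      also have "\<dots> \<le> theta 2 * real (unit_walks 2 2 3 2 r)"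
        using theta_2_ge by (rule mult_right_mono) simp
      finally show "real (unit_walks 2 2 3 (Suc 2) r) \<le> theta 2 * real (unit_walks 2 2 3 2 r)"
        by (simp add: numeral_3_eq_3 numeral_2_eq_2 del: unit_walks.simps)
    qed (use theta_2_ge in \<open>simp_all add: cong_def\<close>)
    show ?thesis using P_bound 1 by blast
  next
    case 2
    interpret prime_sieve 3 1 2 0 "theta 3"
    proof
      fix r :: nat assume "r < 2" "coprime r 2"
      then have "unit_walks 3 1 2 1 r \<le> 2 * unit_walks 3 1 2 0 r"
        using contraction_3 by (simp only: list_all_iff set_upt atLeastLessThan_iff) simp
      then show "real (unit_walks 3 1 2 (Suc 0) r) \<le> theta 3 * real (unit_walks 3 1 2 0 r)"
        by (simp add: theta_def del: unit_walks.simps)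
    qed (simp_all add: theta_def cong_def)
    show ?thesis using P_bound 2 by blast
  next
    case 3
    interpret prime_sieve 5 5 6 0 "theta 5"
    proof
      fix r :: nat assume "r < 6" "coprime r 6"
      then have "unit_walks 5 5 6 1 r \<le> 2 * unit_walks 5 5 6 0 r"
        using contraction_5 by (simp only: list_all_iff set_upt atLeastLessThan_iff) simp
      then show "real (unit_walks 5 5 6 (Suc 0) r) \<le> theta 5 * real (unit_walks 5 5 6 0 r)"
        by (simp add: theta_def del: unit_walks.simps)
    qed (simp_all add: theta_def cong_def)
    show ?thesis using P_bound 3 by blast
  next
    case 4
    interpret prime_sieve 10 82 273 1 "theta 10"
    proof
      fix r :: nat assume "r < 273" "coprime r 273"
      then have "unit_walks 10 82 273 2 r \<le> 6 * unit_walks 10 82 273 1 r"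
        using contraction_10 by (simp only: list_all_iff set_upt atLeastLessThan_iff) simp
      then show "real (unit_walks 10 82 273 (Suc 1) r) \<le> theta 10 * real (unit_walks 10 82 273 1 r)"
        by (simp add: theta_def numeral_2_eq_2 del: unit_walks.simps)
    qed (simp_all add: theta_def cong_def)
    show ?thesis using P_bound 4 by blast
  qed
qed

end
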